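(* Let $C$ be a $2$-torsion free commutative ring with unity, let $n\geq 2$, and let $\mathcal{M}_n(C)$ be the $C$-algebra of $n\times n$ matrices over $C$. Let $f,g,h:\mathcal{M}_n(C)\to\mathcal{M}_n(C)$ be $C$-linear maps such that $f$ is a Jordan left $\{g,h\}$-derivation. Then $g=h$.
   Context: A ring $R$ is $2$-torsion free if $2a=0$ with $a\in R$ implies $a=0$. For an algebra $A$ over $C$ and $C$-linear maps $f,g,h:A\to A$, $f$ is a Jordan left $\{g,h\}$-derivation if $f(ab+ba)=2\big(a\,g(b)+b\,h(a)\big)$ for all $a,b\in A$. *)

theory Defs
  imports "HOL-Analysis.Analysis"
begin

definition mat_scale :: "'a::comm_ring_1 \<Rightarrow> 'a ^ 'n ^ 'm \<Rightarrow> 'a ^ 'n ^ 'm"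
  where "mat_scale c A = (\<chi> i j. c * A $ i $ j)"

lemma module_mat_scale: "module (mat_scale :: 'a::comm_ring_1 \<Rightarrow> 'a ^ 'n ^ 'm \<Rightarrow> _)"
  by unfold_locales (simp_all add: mat_scale_def vec_eq_iff algebra_simps)

(* The multiplication of the algebra is an explicit argument because the type-class
   product on matrices is the entrywise one; the matrix product is (**). *)
definition jordan_left_derivation ::
  "('c::comm_ring_1 \<Rightarrow> 'b::ab_group_add \<Rightarrow> 'b) \<Rightarrow> ('b \<Rightarrow> 'b \<Rightarrow> 'b) \<Rightarrow>
    ('b \<Rightarrow> 'b) \<Rightarrow> ('b \<Rightarrow> 'b) \<Rightarrow> ('b \<Rightarrow> 'b) \<Rightarrow> bool"
  where "jordan_left_derivation scl mul f g h \<longleftrightarrow>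
    (\<forall>a b. f (mul a b + mul b a) = scl 2 (mul a (g b) + mul b (h a)))"

definition two_torsion_free :: "'a::ring itself \<Rightarrow> bool"
  where "two_torsion_free _ \<longleftrightarrow> (\<forall>a::'a. a + a = 0 \<longrightarrow> a = 0)"

end

(* Interchanging a and b in the defining identity and cancelling 2 shows that k = g - h satisfies
   a k(b) = b k(a).  Hence k(a) = a k(1), and k(1) is annihilated on the left by all commutators.
   Since the matrix unit e_ij with i \<noteq> j is the commutator [e_ij, e_jj], this forces k(1) = 0. *)
theory Submission
  imports Defs
begin

text \<open>Commuting matrix units isolates one row of \<open>m\<close> at a time. Only left
  multiplication acts on \<open>m\<close>, so \<open>m\<close> may be rectangular.\<close>

lemma commutators_annihilate_imp_zero:
  fixes m :: "'a::comm_ring_1 ^ 'k ^ 'n"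
  assumes card: "CARD('n) \<ge> 2"
    and comm: "\<And>a b :: 'a ^ 'n ^ 'n. a ** (b ** m) = b ** (a ** m)"
  shows "m = 0"
proof -
  define e :: "'n \<Rightarrow> 'n \<Rightarrow> 'a ^ 'n ^ 'n"
    where "e i j = (\<chi> r s. if r = i \<and> s = j then 1 else 0)" for i j
  \<comment> \<open>Left multiplication by \<open>e i j\<close> moves row \<open>j\<close> to row
    \<open>i\<close> and clears all other rows.\<close>
  have e_mult: "(e i j ** x) $ r $ c = (if r = i then x $ j $ c else 0)"
    for i j r c and x :: "'a ^ 'k ^ 'n"
    by (cases "r = i") (simp_all add: e_def matrix_matrix_mult_def if_distrib [of "\<lambda>y. y * _"] cong: if_cong)
  have "m $ j $ c = 0" for j c
  proof -
    obtain i where "i \<noteq> j"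
      using card ex_card [of 2 "UNIV :: 'n set"] by (metis card_2_iff)
    \<comment> \<open>In row \<open>i\<close> the left side is row \<open>j\<close> of
      \<open>m\<close>; the right side is 0, since \<open>e j j ** _\<close> lives in row
      \<open>j\<close> only.\<close>
    then show ?thesis
      using arg_cong [OF comm [of "e i j" "e j j"], of "\<lambda>x. x $ i $ c"] by (simp add: e_mult)
  qed
  then show ?thesis
    by (simp add: vec_eq_iff)
qed

lemma mat_scale_2_cancel:
  fixes x y :: "'a::comm_ring_1 ^ 'n ^ 'm"
  assumes "two_torsion_free TYPE('a)" and "mat_scale 2 x = mat_scale 2 y"
  shows "x = y"
proof -
  have "x $ i $ j - y $ i $ j = 0" for i j
  proof -
    have "2 * x $ i $ j = 2 * y $ i $ j"
      using assms(2) by (simp add: mat_scale_def vec_eq_iff)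
    then have "(x $ i $ j - y $ i $ j) + (x $ i $ j - y $ i $ j) = 0"
      by (simp add: algebra_simps flip: mult_2)
    then show ?thesis
      using assms(1) unfolding two_torsion_free_def by blast
  qed
  then show ?thesis
    by (simp add: vec_eq_iff)
qed

theorem theorem2p8:
  fixes f g h :: "'a::comm_ring_1 ^ 'n ^ 'n \<Rightarrow> 'a ^ 'n ^ 'n"
  assumes "two_torsion_free TYPE('a)"
    and "CARD('n) \<ge> 2"
    and "module_hom mat_scale mat_scale f"
    and "module_hom mat_scale mat_scale g"
    and "module_hom mat_scale mat_scale h"
    and "jordan_left_derivation mat_scale (**) f g h"
  shows "g = h"
proof -
  define k where "k a = g a - h a" for a
  have g_eq: "g a = k a + h a" for a
    by (simp add: k_def)
  have swap: "a ** k b = b ** k a" for a b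
  proof -
    \<comment> \<open>Both sides equal \<open>f (a ** b + b ** a)\<close>, whose argument is
      symmetric in \<open>a\<close> and \<open>b\<close>.\<close>
    have "mat_scale 2 (a ** g b + b ** h a) = mat_scale 2 (b ** g a + a ** h b)"
      using assms(6) unfolding jordan_left_derivation_def by (metis add.commute)
    then have "a ** g b + b ** h a = b ** g a + a ** h b"
      by (rule mat_scale_2_cancel [OF assms(1)])
    then show ?thesis
      \<comment> \<open>After writing \<open>g\<close> as \<open>k + h\<close>, the terms
        \<open>a ** h b\<close> and \<open>b ** h a\<close> occur on both sides and cancel.\<close>
      by (simp add: g_eq matrix_add_ldistrib)
  qed
  have k_eq: "k a = a ** k (mat 1)" for a
    using swap [of "mat 1" a] by simp
  have "a ** (b ** k (mat 1)) = b ** (a ** k (mat 1))" for a b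
    using swap [of a b] by (simp flip: k_eq)
  then have "k (mat 1) = 0"
    by (rule commutators_annihilate_imp_zero [OF assms(2)])
  then have "k a = 0" for a
    using k_eq [of a] by simp
  then show ?thesis
    by (simp add: fun_eq_iff k_def)
qed

end
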